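(* Let $W$ be an irreducible $T$-module with endpoint $r$ and diameter $d=D-2r$. Let $u\in E_rW$, $u^*\in E_r^*W$, $u^{\varepsilon}\in E_r^{\varepsilon}W$ be nonzero vectors. Consider the $(d+1)\times(d+1)$ tridiagonal matrix $$B=\mathbf{i}\begin{pmatrix}0&-d&&&&0\\1&0&1-d&&&\\&2&\cdot&\cdot&&\\&&\cdot&\cdot&\cdot&\\&&&\cdot&\cdot&-1\\0&&&&d&0\end{pmatrix},$$ i.e. $B_{i,i-1}=\mathbf{i}\,i$ for $1\le i\le d$, $B_{i,i+1}=\mathbf{i}(i-d)$ for $0\le i\le d-1$, and all other entries are $0$. Then the following hold. (i) $B$ represents $A$ with respect to the basis $E^*_ru^{\varepsilon},\ldots,E^*_{r+d}u^{\varepsilon}$ of $W$. (ii) $B$ represents $A^*$ with respect to the basis $E^{\varepsilon}_ru,\ldots,E^{\varepsilon}_{r+d}u$ of $W$. (iii) $B$ represents $A^{\varepsilon}$ with respect to the basis $E_ru^*,\ldots,E_{r+d}u^*$ of $W$.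
   Context: Let $D$ be a positive integer and let $Q_D$ be the $D$-cube: the graph with vertex set $X=\{0,1\}^D$, two vertices being adjacent iff they differ in exactly one coordinate; $\partial$ denotes path-length distance. $\mathrm{Mat}_X(\mathbb{C})$ is the algebra of complex matrices with rows and columns indexed by $X$, acting on $V=\mathbb{C}^X$ (column vectors) by left multiplication. Write $\mathbf{i}^2=-1$ (the bold $\mathbf{i}$ is the imaginary unit; the plain $i$ is an index). Let $A$ be the adjacency matrix of $Q_D$. Fix $x=(0,0,\ldots,0)\in X$. Let $A^*$ be the diagonal matrix in $\mathrm{Mat}_X(\mathbb{C})$ with $(y,y)$-entry $D-2\partial(x,y)$ for $y\in X$, and let $A^{\varepsilon}=-\mathbf{i}(AA^*-A^*A)/2$. Let $T$ be the subalgebra of $\mathrm{Mat}_X(\mathbb{C})$ generated by $A$ and $A^*$. The eigenvalues of $A$ are $\theta_i=D-2i$ $(0\le i\le D)$. For $0\le i\le D$: $E_i=\prod_{0\le j\le D,\,j\ne i}\frac{A-\theta_jI}{\theta_i-\theta_j}$ is the primitive idempotent of $A$ for $\theta_i$ (the orthogonal projection onto the $\theta_i$-eigenspace of $A$); $E_i^*$ is the diagonal matrix with $(y,y)$-entry $1$ if $\partial(x,y)=i$ and $0$ otherwise; and $E_i^{\varepsilon}=P^{-1}E_iP$, where $P=P_1^{\otimes D}$ (Kronecker power, $P_{yz}=\prod_{k=1}^D(P_1)_{y_kz_k}$, invertible) with $P_1=\begin{pmatrix}1&1\\-\mathbf{i}&\mathbf{i}\end{pmatrix}$, rows and columns indexed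 by $0,1$ in that order. ($E_i^*$ and $E_i^{\varepsilon}$ are the primitive idempotents of $A^*$ and $A^{\varepsilon}$ for the eigenvalue $D-2i$.) A $T$-module is a subspace $W\subseteq V$ with $BW\subseteq W$ for all $B\in T$; it is irreducible if $W\ne0$ and it contains no $T$-modules other than $0$ and $W$. The endpoint of an irreducible $T$-module $W$ is $r=\min\{i\mid 0\le i\le D,\ E_i^*W\neq0\}$ (it is known that also $r=\min\{i\mid E_iW\ne0\}$), and its diameter is $d=|\{i\mid 0\le i\le D,\ E_i^*W\ne0\}|-1$; it is known that $d=D-2r$ and $0\le r\le D/2$. For nonzero $u\in E_rW$, $u^*\in E^*_rW$, $u^{\varepsilon}\in E^{\varepsilon}_rW$, each of the six sequences $(E^*_{r+i}u)_{i=0}^d$, $(E^{\varepsilon}_{r+i}u)_{i=0}^d$, $(E^{\varepsilon}_{r+i}u^* )_{i=0}^d$, $(E_{r+i}u^* )_{i=0}^d$, $(E_{r+i}u^{\varepsilon})_{i=0}^d$, $(E^*_{r+i}u^{\varepsilon})_{i=0}^d$ is a basis of $W$. Convention: a $(d+1)\times(d+1)$ matrix $B$ (rows and columns indexed $0,\ldots,d$) represents $Y\in T$ with respect to a basis $v_0,\ldots,v_d$ of $W$ if $Yv_j=\sum_{i=0}^dB_{ij}v_i$ for $0\le j\le d$. *)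

theory Defs
  imports "HOL-Analysis.Analysis"
begin

text \<open>
  The coordinates of the cube are indexed by an arbitrary finite type \<open>'n\<close>, so \<open>D = CARD('n)\<close>,
  which is automatically positive. The symbols 0 and 1 are \<^const>\<open>False\<close> and \<^const>\<open>True\<close>.
  On the vector type, \<open>*\<close> is the componentwise product; the matrix product is \<open>**\<close>, and \<open>*v\<close> is
  the action on column vectors.
\<close>

type_synonym 'n cube = "(bool, 'n) vec"
type_synonym 'n cvec = "(complex, 'n cube) vec"
type_synonym 'n cmat = "('n cvec, 'n cube) vec"

definition cube_adj :: "'n::finite cube \<Rightarrow> 'n cube \<Rightarrow> bool" where
  "cube_adj y z \<longleftrightarrow> card {k. y $ k \<noteq> z $ k} = 1"

text \<open>Path-length distance: the least length of a walk (the cube is connected).\<close>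

definition cube_dist :: "'n::finite cube \<Rightarrow> 'n cube \<Rightarrow> nat" where
  "cube_dist y z = (LEAST n. (cube_adj ^^ n) y z)"

definition base_vertex :: "'n::finite cube" where
  "base_vertex = (\<chi> k. False)"

definition mat_scale :: "complex \<Rightarrow> 'n::finite cmat \<Rightarrow> 'n cmat" where
  "mat_scale c M = (\<chi> y z. c * M $ y $ z)"

definition adj_mat :: "'n::finite cmat" where
  "adj_mat = (\<chi> y z. if cube_adj y z then 1 else 0)"

definition theta :: "'n::finite itself \<Rightarrow> nat \<Rightarrow> complex" where
  "theta _ i = of_nat CARD('n) - 2 * of_nat i"

definition dual_adj_mat :: "'n::finite cmat" where
  "dual_adj_mat =
     (\<chi> y z. if y = z then of_nat CARD('n) - 2 * of_nat (cube_dist base_vertex y) else 0)"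

definition eps_adj_mat :: "'n::finite cmat" where
  "eps_adj_mat =
     mat_scale (- \<i> / 2) (adj_mat ** dual_adj_mat - dual_adj_mat ** adj_mat)"

definition complex_subalgebra :: "'n::finite cmat set \<Rightarrow> bool" where
  "complex_subalgebra S \<longleftrightarrow>
     mat 1 \<in> S \<and>
     (\<forall>M\<in>S. \<forall>N\<in>S. M + N \<in> S) \<and>
     (\<forall>c. \<forall>M\<in>S. mat_scale c M \<in> S) \<and>
     (\<forall>M\<in>S. \<forall>N\<in>S. M ** N \<in> S)"

definition terwilliger_algebra :: "'n::finite cmat set" where
  "terwilliger_algebra = complex_subalgebra hull {adj_mat, dual_adj_mat}"

text \<open>
  The product over \<open>j \<noteq> i\<close> is taken as a matrix product in increasing order of \<open>j\<close>; the factors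
  commute, so the order is irrelevant.
\<close>

definition idem :: "nat \<Rightarrow> 'n::finite cmat" where
  "idem i = foldr
     (\<lambda>j M. mat_scale (1 / (theta TYPE('n) i - theta TYPE('n) j))
              (adj_mat - mat_scale (theta TYPE('n) j) (mat 1)) ** M)
     (filter (\<lambda>j. j \<noteq> i) [0..<Suc CARD('n)]) (mat 1)"

definition dual_idem :: "nat \<Rightarrow> 'n::finite cmat" where
  "dual_idem i = (\<chi> y z. if y = z \<and> cube_dist base_vertex y = i then 1 else 0)"

definition P1 :: "bool \<Rightarrow> bool \<Rightarrow> complex" where
  "P1 a b = (if \<not> a then 1 else if b then \<i> else - \<i>)"

definition P_mat :: "'n::finite cmat" where
  "P_mat = (\<chi> y z. \<Prod>k\<in>UNIV. P1 (y $ k) (z $ k))"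

definition eps_idem :: "nat \<Rightarrow> 'n::finite cmat" where
  "eps_idem i = matrix_inv P_mat ** idem i ** P_mat"

text \<open>Subspaces, spans and independence are over the complex field, hence the \<open>vec\<close> versions.\<close>

definition T_module :: "'n::finite cvec set \<Rightarrow> bool" where
  "T_module W \<longleftrightarrow>
     vec.subspace W \<and> (\<forall>M\<in>terwilliger_algebra. \<forall>w\<in>W. M *v w \<in> W)"

definition irreducible_T_module :: "'n::finite cvec set \<Rightarrow> bool" where
  "irreducible_T_module W \<longleftrightarrow>
     T_module W \<and> W \<noteq> {0} \<and>
     (\<forall>U. T_module U \<and> U \<subseteq> W \<longrightarrow> U = {0} \<or> U = W)"

definition dual_support :: "'n::finite cvec set \<Rightarrow> nat set" where
  "dual_support W = {i. i \<le> CARD('n) \<and> (*v) (dual_idem i) ` W \<noteq> {0}}"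

definition endpoint :: "'n::finite cvec set \<Rightarrow> nat" where
  "endpoint W = Min (dual_support W)"

definition diameter_of :: "'n::finite cvec set \<Rightarrow> nat" where
  "diameter_of W = card (dual_support W) - 1"

definition is_basis :: "nat \<Rightarrow> (nat \<Rightarrow> 'n::finite cvec) \<Rightarrow> 'n cvec set \<Rightarrow> bool" where
  "is_basis d v W \<longleftrightarrow>
     inj_on v {0..d} \<and> vec.independent (v ` {0..d}) \<and> vec.span (v ` {0..d}) = W"

text \<open>
  A \<open>(d+1)\<times>(d+1)\<close> matrix is a function on pairs of indices, of which only the entries with both
  indices at most \<open>d\<close> are used.
\<close>

definition represents ::
    "nat \<Rightarrow> (nat \<Rightarrow> nat \<Rightarrow> complex) \<Rightarrow> 'n::finite cmat \<Rightarrow> (nat \<Rightarrow> 'n cvec) \<Rightarrow> 'n cvec set \<Rightarrow> bool"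
  where
  "represents d B Y v W \<longleftrightarrow>
     is_basis d v W \<and> (\<forall>j\<le>d. Y *v v j = (\<Sum>i=0..d. B i j *s v i))"

definition tridiag :: "nat \<Rightarrow> nat \<Rightarrow> nat \<Rightarrow> complex" where
  "tridiag d i j =
     (if i = j + 1 then \<i> * of_nat i
      else if j = i + 1 then \<i> * (of_nat i - of_nat d)
      else 0)"

end

theory Submission
  imports Defs
begin

text \<open>
  The matrices \<open>A, A*, A\<^sup>\<epsilon>\<close> satisfy \<open>[X, Y] = 2\<i> Z\<close> for each cyclic rotation \<open>(X, Y, Z)\<close>, and
  conjugation by \<open>P\<close> permutes them cyclically, so it suffices to treat one rotation: expand a vector
  \<open>w \<in> W\<close> of highest \<open>Z\<close>-weight \<open>D - 2r\<close> into its \<open>Y\<close>-components. Since \<open>X + \<i> Y\<close> kills \<open>w\<close>, the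
  components of \<open>w\<close> are shifted by \<open>X \<plusminus> \<i> Z\<close> with explicit coefficients. These coefficients show that
  exactly the components \<open>r, \<dots>, D - r\<close> are nonzero and that their span is a submodule, hence all of
  \<open>W\<close>. In particular the smallest index in the \<open>Z\<close>-support of \<open>W\<close> is the smallest one in its
  \<open>Y\<close>-support, and going round the cycle the three endpoints agree.
\<close>

section \<open>Irreducible modules of a cyclic triple\<close>

lemma mat_scale_mult_vec [simp]: "mat_scale c M *v x = c *s (M *v x)"
  by (simp add: mat_scale_def matrix_vector_mult_def vec_eq_iff sum_distrib_left mult.assoc)

definition weight :: "nat \<Rightarrow> nat \<Rightarrow> complex" where
  "weight D i = of_nat D - 2 * of_nat i"

lemma weight_inject [simp]: "weight D i = weight D j \<longleftrightarrow> i = j"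
  by (simp add: weight_def)

lemma weight_Suc: "weight D (Suc i) = weight D i - 2"
  by (simp add: weight_def algebra_simps)

text \<open>\<open>weight D 0\<close> is the largest weight, so raising a vector of index 0 leads
  outside the spectrum.\<close>

lemma weight_0_plus_2: "weight D i \<noteq> weight D 0 + 2"
proof
  assume "weight D i = weight D 0 + 2"
  then have "Re (weight D i) = Re (weight D 0 + 2)" by simp
  then show False by (simp add: weight_def)
qed

text \<open>An abstract family of spectral projections of \<open>Y\<close>; idempotence and
  orthogonality are derived in \<open>F_F\<close>. \<open>F_big\<close> extends the family by zero,
  so that index shifts need no upper bound.\<close>

locale weight_resolution =
  fixes D :: nat and Y :: "'n::finite cmat" and F :: "nat \<Rightarrow> 'n cmat"
  assumes F_sum: "(\<Sum>i\<le>D. F i *v x) = x"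
    and F_big: "i > D \<Longrightarrow> F i *v x = 0"
    and Y_F: "Y *v (F i *v x) = weight D i *s (F i *v x)"
    and F_Y: "F i *v (Y *v x) = weight D i *s (F i *v x)"
begin

lemma F_eigenvector_neq:
  assumes "Y *v x = c *s x" "c \<noteq> weight D k"
  shows "F k *v x = 0"
proof -
  have "weight D k *s (F k *v x) = c *s (F k *v x)"
    using F_Y[of k x] assms(1) by (auto simp: vector_scalar_commute)
  with assms(2) show ?thesis by (metis vec.scale_cancel_right)
qed

lemma eigenvector_eq_0:
  assumes "Y *v x = c *s x" "\<And>k. c \<noteq> weight D k"
  shows "x = 0"
  using F_sum[of x] F_eigenvector_neq[OF assms] by simp

lemma F_eigenvector:
  assumes "Y *v x = weight D k *s x"
  shows "F j *v x = (if j = k then x else 0)"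
proof -
  have *: "F j *v x = 0" if "j \<noteq> k" for j
    using F_eigenvector_neq[OF assms, of j] that by auto
  have "x = (\<Sum>i\<le>D. if i = k then F k *v x else 0)"
  proof -
    have "(\<Sum>i\<le>D. F i *v x) = (\<Sum>i\<le>D. if i = k then F k *v x else 0)"
      using * by (intro sum.cong) auto
    then show ?thesis by (simp add: F_sum)
  qed
  then have "F k *v x = x"
    using F_big[of k x] by (cases "k \<le> D") auto
  with * show ?thesis by auto
qed

lemma F_F: "F j *v (F k *v x) = (if j = k then F k *v x else 0)"
  by (rule F_eigenvector[OF Y_F])

text \<open>Weights fall as indices rise, so \<open>L\<close> carries the component of index
  \<open>n\<close> to index \<open>n + 1\<close>, and nothing lands in index 0.\<close>

lemma lowering_commute:
  assumes L: "\<And>x. Y *v (L *v x) = L *v (Y *v x) - 2 *s (L *v x)"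
  shows "F (Suc n) *v (L *v x) = L *v (F n *v x)" and "F 0 *v (L *v x) = 0"
proof -
  have *: "Y *v (L *v (F k *v x)) = weight D (Suc k) *s (L *v (F k *v x))" for k
    by (simp add: L Y_F vector_scalar_commute weight_Suc vec.scale_left_diff_distrib)
  have **: "F m *v (L *v x) = (\<Sum>k\<le>D. if m = Suc k then L *v (F k *v x) else 0)" for m
  proof -
    have "F m *v (L *v x) = F m *v (L *v (\<Sum>k\<le>D. F k *v x))" by (simp add: F_sum)
    also have "\<dots> = (\<Sum>k\<le>D. F m *v (L *v (F k *v x)))"
      by (simp add: vec.linear_sum[OF matrix_vector_mul_linear_gen])
    also have "\<dots> = (\<Sum>k\<le>D. if m = Suc k then L *v (F k *v x) else 0)"
      using F_eigenvector[OF *, of m] by (intro sum.cong) auto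
    finally show ?thesis .
  qed
  show "F (Suc n) *v (L *v x) = L *v (F n *v x)"
    using **[of "Suc n"] F_big[of n x] by (cases "n \<le> D") auto
  show "F 0 *v (L *v x) = 0" using **[of 0] by simp
qed

text \<open>The mirror image: indices drop by one. At index 0 the image would be an eigenvector for
  \<open>D + 2\<close>, which is no weight, hence it vanishes.\<close>

lemma raising_commute:
  assumes R: "\<And>x. Y *v (R *v x) = R *v (Y *v x) + 2 *s (R *v x)"
  shows "F n *v (R *v x) = R *v (F (Suc n) *v x)" and "R *v (F 0 *v x) = 0"
proof -
  have *: "Y *v (R *v (F k *v x)) = (weight D k + 2) *s (R *v (F k *v x))" for k
    by (simp add: R Y_F vector_scalar_commute vec.scale_left_distrib)
  have 0: "R *v (F 0 *v x) = 0" for x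
  proof (rule eigenvector_eq_0)
    show "Y *v (R *v (F 0 *v x)) = (weight D 0 + 2) *s (R *v (F 0 *v x))"
      by (simp add: R Y_F vector_scalar_commute vec.scale_left_distrib)
  qed (metis weight_0_plus_2)
  then show "R *v (F 0 *v x) = 0" .
  have 1: "F m *v (R *v (F k *v x)) = (if k = Suc m then R *v (F k *v x) else 0)" for m k
  proof (cases k)
    case (Suc j)
    then have "Y *v (R *v (F k *v x)) = weight D j *s (R *v (F k *v x))"
      using *[of k] by (simp add: weight_Suc)
    from F_eigenvector[OF this, of m] show ?thesis using Suc by auto
  qed (simp add: 0)
  have "F n *v (R *v x) = F n *v (R *v (\<Sum>k\<le>D. F k *v x))" by (simp add: F_sum)
  also have "\<dots> = (\<Sum>k\<le>D. F n *v (R *v (F k *v x)))"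
    by (simp add: vec.linear_sum[OF matrix_vector_mul_linear_gen])
  also have "\<dots> = (\<Sum>k\<le>D. if k = Suc n then R *v (F k *v x) else 0)"
    by (simp add: 1)
  also have "\<dots> = R *v (F (Suc n) *v x)"
    using F_big[of "Suc n" x] by (cases "Suc n \<le> D") auto
  finally show "F n *v (R *v x) = R *v (F (Suc n) *v x)" .
qed

lemma F_eigenspace:
  assumes "w \<in> (*v) (F k) ` W"
  shows "Y *v w = weight D k *s w"
  using assms Y_F by auto

end

definition support :: "nat \<Rightarrow> (nat \<Rightarrow> 'n::finite cmat) \<Rightarrow> 'n cvec set \<Rightarrow> nat set" where
  "support D F W = {i. i \<le> D \<and> (*v) (F i) ` W \<noteq> {0}}"

lemma finite_support: "finite (support D F W)"
  by (simp add: support_def)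

lemma (in weight_resolution) support_nonempty:
  assumes "vec.subspace W" "W \<noteq> {0}"
  shows "support D F W \<noteq> {}"
proof
  assume "support D F W = {}"
  then have *: "F i *v x = 0" if "x \<in> W" "i \<le> D" for x i
    using that unfolding support_def by blast
  obtain x where "x \<in> W" "x \<noteq> 0" using assms vec.subspace_0 by blast
  then show False using F_sum[of x] * by simp
qed

text \<open>The brackets are the relations of sl2 in the form satisfied by the Pauli matrices,
  invariant under rotation of \<open>X, Y, Z\<close>; the three rotations give the three claims.
  Vectors are taken from a \<open>Z\<close>-eigenspace and expanded along \<open>Y\<close>;
  \<open>X\<close> is the matrix to be represented.\<close>

locale irreducible_triple = Y: weight_resolution D Y F + Z: weight_resolution D Z G
  for D :: nat and X Y Z :: "'n::finite cmat" and F G +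
  fixes W :: "'n cvec set"
  assumes XY: "X *v (Y *v x) - Y *v (X *v x) = (2 * \<i>) *s (Z *v x)"
    and YZ: "Y *v (Z *v x) - Z *v (Y *v x) = (2 * \<i>) *s (X *v x)"
    and ZX: "Z *v (X *v x) - X *v (Z *v x) = (2 * \<i>) *s (Y *v x)"
    and W: "vec.subspace W" "W \<noteq> {0}"
    and W_X: "w \<in> W \<Longrightarrow> X *v w \<in> W"
    and W_Y: "w \<in> W \<Longrightarrow> Y *v w \<in> W"
    and W_F: "w \<in> W \<Longrightarrow> F i *v w \<in> W"
    and W_G: "w \<in> W \<Longrightarrow> G i *v w \<in> W"
    and irr: "\<lbrakk>vec.subspace U; U \<subseteq> W; \<And>w. w \<in> U \<Longrightarrow> X *v w \<in> U; \<And>w. w \<in> U \<Longrightarrow> Y *v w \<in> U;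
               \<And>w. w \<in> U \<Longrightarrow> Z *v w \<in> U\<rbrakk> \<Longrightarrow> U = {0} \<or> U = W"
begin

abbreviation "r \<equiv> Min (support D G W)"

text \<open>
  \<open>X + \<i> Y\<close> raises \<open>Z\<close>-weights by 2, so it kills the vectors of highest \<open>Z\<close>-weight.
\<close>
lemma highest_weight_killed:
  assumes w: "w \<in> (*v) (G r) ` W"
  shows "X *v w = - \<i> *s (Y *v w)"
proof -
  have wW: "w \<in> W" using w W_G by auto
  have Zw: "Z *v w = weight D r *s w" using w by (rule Z.F_eigenspace)
  define z where "z = X *v w + \<i> *s (Y *v w)"
  have zW: "z \<in> W" unfolding z_def
    using W(1) W_X[OF wW] W_Y[OF wW] by (simp add: vec.subspace_add vec.subspace_scale)
  have a: "Z *v (X *v w) = weight D r *s (X *v w) + (2 * \<i>) *s (Y *v w)"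
    using ZX[of w] Zw by (simp add: vector_scalar_commute algebra_simps)
  have b: "Z *v (Y *v w) = weight D r *s (Y *v w) - (2 * \<i>) *s (X *v w)"
    using YZ[of w] Zw by (simp add: vector_scalar_commute algebra_simps)
  have Zz: "Z *v z = (weight D r + 2) *s z"
    by (simp add: z_def matrix_vector_right_distrib vector_scalar_commute a b vec_eq_iff algebra_simps)
  \<comment> \<open>Below \<open>r\<close> the index lies outside the support of \<open>W\<close>;
    from \<open>r\<close> on, the weight of \<open>z\<close> is too large for index
    \<open>i\<close>.\<close>
  have "G i *v z = 0" if "i \<le> D" for i
  proof (cases "i < r")
    case True
    then have "i \<notin> support D G W"
      using Min_le[OF finite_support, of i] by fastforce
    then have "(*v) (G i) ` W = {0}" using that by (simp add: support_def)
    then show ?thesis using zW by auto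
  next
    case False
    have "weight D r + 2 \<noteq> weight D i"
    proof
      assume "weight D r + 2 = weight D i"
      then have "Re (weight D r + 2) = Re (weight D i)" by simp
      then show False using False by (simp add: weight_def)
    qed
    with Zz show ?thesis by (rule Z.F_eigenvector_neq)
  qed
  then have "z = 0" using Z.F_sum[of z] by simp
  then show ?thesis unfolding z_def by (simp add: add_eq_0_iff2)
qed

text \<open>
  With \<open>L = (X + \<i> Z) / 2\<close> and \<open>R = (X - \<i> Z) / 2\<close>, which shift the \<open>Y\<close>-weights by \<open>-2\<close> and \<open>2\<close>,
  the equations for \<open>X w\<close> and \<open>Z w\<close> give \<open>L w = (\<i>/2) (D - 2r - Y) w\<close> and
  \<open>R w = -(\<i>/2) (D - 2r + Y) w\<close>; the statement compares \<open>Y\<close>-components.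
\<close>
lemma component_relations:
  assumes w: "w \<in> (*v) (G r) ` W"
  defines "f \<equiv> \<lambda>n. F n *v w"
  obtains L R :: "'n cmat" where
    "\<And>x. X *v x = L *v x + R *v x"
    "\<And>x. Z *v x = - \<i> *s (L *v x) + \<i> *s (R *v x)"
    "\<And>n. L *v f n = (\<i> * (of_nat (Suc n) - of_nat r)) *s f (Suc n)"
    "\<And>n. R *v f (Suc n) = (- \<i> * (of_nat D - of_nat n - of_nat r)) *s f n"
    "of_nat r *s f 0 = 0" "R *v f 0 = 0"
proof -
  define L where "L = mat_scale (1/2) (X + mat_scale \<i> Z)"
  define R where "R = mat_scale (1/2) (X - mat_scale \<i> Z)"
  have L: "L *v x = (1/2) *s (X *v x + \<i> *s (Z *v x))" for x
    by (simp add: L_def matrix_vector_mult_add_rdistrib)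
  have R: "R *v x = (1/2) *s (X *v x - \<i> *s (Z *v x))" for x
    by (simp add: R_def matrix_vector_mult_diff_rdistrib)
  have Xw: "X *v w = - \<i> *s (Y *v w)" using w by (rule highest_weight_killed)
  have Zw: "Z *v w = weight D r *s w" using w by (rule Z.F_eigenspace)
  have YX: "Y *v (X *v x) = X *v (Y *v x) - (2 * \<i>) *s (Z *v x)" for x
    using XY[of x] by (simp add: algebra_simps)
  have YZ': "Y *v (Z *v x) = Z *v (Y *v x) + (2 * \<i>) *s (X *v x)" for x
    using YZ[of x] by (simp add: algebra_simps)
  have comm: "Y *v (L *v x) = L *v (Y *v x) - 2 *s (L *v x)"
    "Y *v (R *v x) = R *v (Y *v x) + 2 *s (R *v x)" for x
    by (simp_all add: L R matrix_vector_right_distrib matrix_vector_mult_diff_distrib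
        vector_scalar_commute YX YZ' vec_eq_iff algebra_simps)
  have Lw: "F n *v (L *v w) = (\<i>/2 * (weight D r - weight D n)) *s f n" for n
    by (simp add: L Xw Zw f_def matrix_vector_right_distrib vector_scalar_commute Y.F_Y vec_eq_iff
        algebra_simps)
  have Rw: "F n *v (R *v w) = (- \<i>/2 * (weight D r + weight D n)) *s f n" for n
  proof -
    have "R *v w = (- \<i>/2) *s (Y *v w + weight D r *s w)"
      by (simp add: R Xw Zw vec_eq_iff algebra_simps)
    then show ?thesis
      by (simp only: f_def matrix_vector_right_distrib vector_scalar_commute Y.F_Y)
        (simp add: vec_eq_iff algebra_simps)
  qed
  show thesis
  proof
    show "X *v x = L *v x + R *v x" for x by (simp add: L R vec_eq_iff algebra_simps)
    show "Z *v x = - \<i> *s (L *v x) + \<i> *s (R *v x)" for x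
      by (simp add: L R vec_eq_iff algebra_simps)
    show "L *v f n = (\<i> * (of_nat (Suc n) - of_nat r)) *s f (Suc n)" for n
      using Y.lowering_commute(1)[OF comm(1), of n w] Lw[of "Suc n"]
      by (simp add: f_def weight_def algebra_simps)
    show "R *v f (Suc n) = (- \<i> * (of_nat D - of_nat n - of_nat r)) *s f n" for n
      using Y.raising_commute(1)[OF comm(2), of n w] Rw[of n]
      by (simp add: f_def weight_def algebra_simps)
    show "of_nat r *s f 0 = 0"
      using Y.lowering_commute(2)[OF comm(1), of w] Lw[of 0]
      by (simp add: f_def weight_def)
    show "R *v f 0 = 0"
      using Y.raising_commute(2)[OF comm(2), of w] by (simp add: f_def)
  qed
qed

text \<open>The shift coefficients vanish only where \<open>L\<close> would enter index
  \<open>r\<close> from below and where \<open>R\<close> would enter index \<open>D - r\<close> from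
  above. Between these two places a nonzero component forces its neighbours to be nonzero.\<close>

lemma represents_tridiag:
  assumes w: "w \<in> (*v) (G r) ` W" "w \<noteq> 0"
  shows "represents (D - 2 * r) (tridiag (D - 2 * r)) X (\<lambda>i. F (r + i) *v w) W"
    and "support D F W = {r..D - r}" and "2 * r \<le> D"
proof -
  define f where "f = (\<lambda>n. F n *v w)"
  define d where "d = D - 2 * r"
  obtain L R :: "'n cmat" where
    X: "\<And>x. X *v x = L *v x + R *v x" and
    Z: "\<And>x. Z *v x = - \<i> *s (L *v x) + \<i> *s (R *v x)" and
    L: "\<And>n. L *v f n = (\<i> * (of_nat (Suc n) - of_nat r)) *s f (Suc n)" and
    R: "\<And>n. R *v f (Suc n) = (- \<i> * (of_nat D - of_nat n - of_nat r)) *s f n" and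
    f0: "of_nat r *s f 0 = 0" "R *v f 0 = 0"
    using component_relations[OF w(1)] unfolding f_def by metis
  have wW: "w \<in> W" using w(1) W_G by auto
  have fW: "f n \<in> W" for n unfolding f_def using wW by (rule W_F)
  have up: "f (Suc n) \<noteq> 0" if "f n \<noteq> 0" "n + r \<noteq> D" for n
  proof
    assume "f (Suc n) = 0"
    with R[of n] have "(- \<i> * (of_nat D - of_nat n - of_nat r)) *s f n = 0" by simp
    moreover have "(of_nat D - of_nat n - of_nat r :: complex) \<noteq> 0"
    proof
      assume "(of_nat D - of_nat n - of_nat r :: complex) = 0"
      then have "of_nat D = (of_nat (n + r) :: complex)" by (simp add: algebra_simps)
      then show False using that(2) by (simp only: of_nat_eq_iff)
    qed
    ultimately show False using that(1) by (simp del: mult_minus_left)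
  qed
  have down: "f n \<noteq> 0" if "f (Suc n) \<noteq> 0" "Suc n \<noteq> r" for n
  proof
    assume "f n = 0"
    with L[of n] have "(\<i> * (of_nat (Suc n) - of_nat r)) *s f (Suc n) = 0" by simp
    moreover have "(of_nat (Suc n) - of_nat r :: complex) \<noteq> 0"
      using that(2) by (simp only: right_minus_eq of_nat_eq_iff) simp
    ultimately show False using that(1) by (simp del: of_nat_Suc)
  qed
  \<comment> \<open>If \<open>0 < r\<close>, then \<open>f 0 = 0\<close> by \<open>f0(1)\<close>,
    and the contrapositive of \<open>down\<close> carries the zero up to index
    \<open>r - 1\<close>.\<close>
  have low: "f n = 0" if "n < r" for n
    using that
  proof (induction n)
    case 0 then show ?case using f0(1) by simp
  next
    case (Suc n) then show ?case using down[of n] by auto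
  qed
  \<comment> \<open>A nonzero component beyond \<open>D - r\<close> would propagate upwards forever,
    although all components beyond \<open>D\<close> vanish.\<close>
  have high: "f n = 0" if "n + r > D" for n
  proof (rule ccontr)
    assume "f n \<noteq> 0"
    then have "f (n + k) \<noteq> 0" for k
    proof (induction k)
      case (Suc k) then show ?case using up[of "n + k"] that by simp
    qed simp
    from this[of "Suc D"] show False by (simp add: f_def Y.F_big)
  qed
  \<comment> \<open>The components sum to \<open>w\<close>, which is nonzero. From \<open>m\<close>
    one descends to \<open>r\<close> by \<open>down\<close> and then climbs to \<open>D - r\<close>
    by \<open>up\<close>.\<close>
  obtain m where m: "f m \<noteq> 0"
    using Y.F_sum[of w] w(2) unfolding f_def by (metis sum.neutral)
  have mr: "r \<le> m" "m + r \<le> D" using m low high by (meson leI)+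
  then show rD: "2 * r \<le> D" by simp
  have fr: "f r \<noteq> 0"
  proof -
    have "f (m - k) \<noteq> 0" if "k \<le> m - r" for k
      using that
    proof (induction k)
      case 0 then show ?case using m by simp
    next
      case (Suc k)
      then have "m - k = Suc (m - Suc k)" by simp
      with Suc down[of "m - Suc k"] show ?case by simp
    qed
    from this[of "m - r"] show ?thesis using mr by simp
  qed
  have nz: "f (r + k) \<noteq> 0" if "k \<le> d" for k
    using that
  proof (induction k)
    case (Suc k) then show ?case using up[of "r + k"] by (simp add: d_def)
  qed (simp add: fr)
  have FF: "F n *v f m = (if n = m then f m else 0)" for n m
    unfolding f_def by (rule Y.F_F)
  have inj: "inj_on (\<lambda>i. f (r + i)) {0..d}"
  proof (rule inj_onI)
    fix i j assume "i \<in> {0..d}" "j \<in> {0..d}" "f (r + i) = f (r + j)"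
    then show "i = j" using FF[of "r + i" "r + i"] FF[of "r + i" "r + j"] nz[of i]
      by (auto split: if_splits)
  qed
  let ?S = "(\<lambda>i. f (r + i)) ` {0..d}"
  \<comment> \<open>The projection onto component \<open>r + k\<close> isolates a single coefficient
    of a linear dependence.\<close>
  have ind: "vec.independent ?S"
  proof
    assume "vec.dependent ?S"
    then obtain c v where c: "(\<Sum>v\<in>?S. c v *s v) = 0" and v: "v \<in> ?S" "c v \<noteq> 0"
      by (auto simp: vec.dependent_finite)
    then obtain k where k: "k \<in> {0..d}" "v = f (r + k)" by auto
    have "0 = F (r + k) *v (\<Sum>v\<in>?S. c v *s v)" by (simp add: c)
    also have "\<dots> = F (r + k) *v (\<Sum>i\<in>{0..d}. c (f (r + i)) *s f (r + i))"
      by (simp add: sum.reindex[OF inj])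
    also have "\<dots> = (\<Sum>i\<in>{0..d}. c (f (r + i)) *s (F (r + k) *v f (r + i)))"
      by (simp add: vec.linear_sum[OF matrix_vector_mul_linear_gen] vector_scalar_commute)
    also have "\<dots> = (\<Sum>i\<in>{0..d}. if i = k then c v *s v else 0)"
      by (intro sum.cong) (auto simp: FF k(2))
    also have "\<dots> = c v *s v" using k(1) by simp
    finally show False using v(2) nz[of k] k by simp
  qed
  let ?U = "vec.span ?S"
  \<comment> \<open>Components outside the range are zero, so membership holds for every
    \<open>n\<close> and the closure arguments have no boundary cases.\<close>
  have fU: "f n \<in> ?U" for n
  proof (cases "r \<le> n \<and> n + r \<le> D")
    case True
    then have "n = r + (n - r)" "n - r \<in> {0..d}" by (auto simp: d_def)
    then show ?thesis by (metis (no_types, lifting) image_eqI vec.span_base)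
  next
    case False
    then have "f n = 0" using low high by (meson not_le)
    then show ?thesis by (simp add: vec.span_zero)
  qed
  have LU: "L *v f n \<in> ?U" for n
    by (simp only: L) (intro vec.span_scale fU)
  have RU: "R *v f n \<in> ?U" for n
    by (cases n) (simp_all only: R f0(2) vec.span_zero vec.span_scale fU)
  have Uinv: "M *v x \<in> ?U" if "x \<in> ?U" and M: "\<And>n. M *v f n \<in> ?U" for M x
    using that(1)
  proof (induction rule: vec.span_induct_alt)
    case base then show ?case by (simp add: vec.span_zero)
  next
    case (step c x y)
    then show ?case using M
      by (auto simp: matrix_vector_right_distrib vector_scalar_commute
          intro!: vec.span_add vec.span_scale)
  qed
  have "?U = {0} \<or> ?U = W"
  proof (rule irr)
    show "?U \<subseteq> W" using fW W(1) by (intro vec.span_minimal) auto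
    show "X *v x \<in> ?U" if "x \<in> ?U" for x
      using that by (rule Uinv) (simp add: X LU RU vec.span_add)
    show "Z *v x \<in> ?U" if "x \<in> ?U" for x
      using that by (rule Uinv) (simp only: Z LU RU vec.span_add vec.span_scale)
    show "Y *v x \<in> ?U" if "x \<in> ?U" for x
      using that
    proof (rule Uinv)
      show "Y *v f n \<in> ?U" for n
        using vec.span_scale[OF fU, of "weight D n" n] by (simp add: f_def Y.Y_F)
    qed
  qed simp
  moreover have "?U \<noteq> {0}" using fU[of r] fr by auto
  ultimately have UW: "?U = W" by simp
  show "support D F W = {r..D - r}"
  proof (intro equalityI subsetI)
    fix n assume n: "n \<in> {r..D - r}"
    then have "f (r + (n - r)) \<noteq> 0" using rD by (intro nz) (auto simp: d_def)
    then have "F n *v w \<noteq> 0" using n by (simp add: f_def)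
    moreover have "n \<le> D" using n by auto
    ultimately show "n \<in> support D F W" using wW unfolding support_def by blast
  next
    fix n assume n: "n \<in> support D F W"
    show "n \<in> {r..D - r}"
    proof (rule ccontr)
      assume "n \<notin> {r..D - r}"
      then have 0: "f n = 0" using low[of n] high[of n] by fastforce
      \<comment> \<open>On the spanning vectors, \<open>F n\<close> gives either 0 or
        \<open>f n\<close>, which is also 0 here.\<close>
      have "F n *v x = 0" if "x \<in> ?U" for x
        using that
      proof (induction rule: vec.span_induct_alt)
        case (step c x y)
        then show ?case
          using 0 by (auto simp: FF matrix_vector_right_distrib vector_scalar_commute split: if_splits)
      qed simp
      then have "(*v) (F n) ` W = {0}" using UW W(2) wW by auto
      then show False using n by (simp add: support_def)
    qed
  qed
  \<comment> \<open>\<open>L\<close> contributes the subdiagonal of the matrix and \<open>R\<close>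
    the superdiagonal.\<close>
  have rep: "X *v f (r + j) = (\<Sum>i=0..d. tridiag d i j *s f (r + i))" if j: "j \<le> d" for j
  proof -
    have Lj: "L *v f (r + j) = (\<Sum>i=0..d. if i = j + 1 then (\<i> * of_nat i) *s f (r + i) else 0)"
    proof (cases "j < d")
      case True then show ?thesis using L[of "r + j"] by (simp add: algebra_simps)
    next
      case False
      \<comment> \<open>Here \<open>j = d\<close>, so the target index is \<open>D - r + 1\<close>;
        this matches the missing term \<open>i = d + 1\<close> of the sum.\<close>
      then have "f (Suc (r + j)) = 0" using j by (intro high) (auto simp: d_def)
      then show ?thesis using False L[of "r + j"] by simp
    qed
    have Rj: "R *v f (r + j) =
        (\<Sum>i=0..d. if j = i + 1 then (\<i> * (of_nat i - of_nat d)) *s f (r + i) else 0)"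
    proof (cases j)
      case 0
      \<comment> \<open>For \<open>r > 0\<close> the image is a multiple of
        \<open>f (r - 1) = 0\<close>; for \<open>r = 0\<close> the weight is already the
        largest.\<close>
      then have "R *v f r = 0"
      proof (cases r)
        case (Suc q)
        then have "f q = 0" by (intro low) simp
        then show ?thesis using R[of q] Suc by simp
      qed (use f0(2) in simp)
      then show ?thesis using 0 by simp
    next
      case (Suc i)
      then have "(\<Sum>i=0..d. if j = i + 1 then (\<i> * (of_nat i - of_nat d)) *s f (r + i) else 0)
          = (\<i> * (of_nat i - of_nat d)) *s f (r + i)"
      proof -
        have "(\<Sum>l=0..d. if j = l + 1 then (\<i> * (of_nat l - of_nat d)) *s f (r + l) else 0)
            = (\<Sum>l=0..d. if l = i then (\<i> * (of_nat i - of_nat d)) *s f (r + i) else 0)"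
          using Suc by (intro sum.cong) auto
        then show ?thesis using j Suc by simp
      qed
      moreover have "(of_nat d :: complex) = of_nat D - 2 * of_nat r"
        using rD by (simp add: d_def of_nat_diff)
      ultimately show ?thesis
        using R[of "r + i"] Suc by (simp only: add_Suc_right of_nat_add) (simp add: algebra_simps)
    qed
    show ?thesis
      unfolding X Lj Rj sum.distrib[symmetric]
      by (intro sum.cong) (auto simp: tridiag_def)
  qed
  show "represents (D - 2 * r) (tridiag (D - 2 * r)) X (\<lambda>i. F (r + i) *v w) W"
    unfolding represents_def is_basis_def d_def[symmetric]
    using inj ind UW rep unfolding f_def by blast
qed

end

section \<open>Lagrange idempotents\<close>

text \<open>The product defining \<open>idem\<close>, with the matrix and the list of nodes left
  free: this permits induction over the list and transport between matrices.\<close>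

definition lagrange :: "'n::finite cmat \<Rightarrow> nat \<Rightarrow> nat list \<Rightarrow> 'n cmat" where
  "lagrange Y i js = foldr
     (\<lambda>j M. mat_scale (1 / (theta TYPE('n) i - theta TYPE('n) j))
              (Y - mat_scale (theta TYPE('n) j) (mat 1)) ** M) js (mat 1)"

lemma lagrange_Nil: "lagrange Y i [] *v x = x"
  by (simp add: lagrange_def)

lemma lagrange_Cons:
  "lagrange (Y :: 'n::finite cmat) i (j # js) *v x =
     (1 / (theta TYPE('n) i - theta TYPE('n) j)) *s
       (Y *v (lagrange Y i js *v x) - theta TYPE('n) j *s (lagrange Y i js *v x))"
  by (simp add: lagrange_def matrix_vector_mul_assoc[symmetric] matrix_vector_mult_diff_rdistrib)

lemma lagrange_invariant:
  assumes "vec.subspace W" "\<And>w. w \<in> W \<Longrightarrow> Y *v w \<in> W" "w \<in> W"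
  shows "lagrange Y i js *v w \<in> W"
proof (induction js)
  case (Cons j js)
  then show ?case unfolding lagrange_Cons
    by (intro vec.subspace_scale vec.subspace_diff assms)
qed (simp add: lagrange_Nil assms)

lemma lagrange_intertwine:
  fixes P Y Y' :: "'n::finite cmat"
  assumes "\<And>x. P *v (Y *v x) = Y' *v (P *v x)"
  shows "P *v (lagrange Y i js *v x) = lagrange Y' i js *v (P *v x)"
  by (induction js)
    (simp_all add: lagrange_Nil lagrange_Cons assms vector_scalar_commute matrix_vector_mult_diff_distrib)

definition lagrange_idem :: "'n::finite cmat \<Rightarrow> nat \<Rightarrow> 'n cmat" where
  "lagrange_idem Y i = lagrange Y i (filter (\<lambda>j. j \<noteq> i) [0..<Suc CARD('n)])"

lemma idem_eq: "idem i = lagrange_idem adj_mat i"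
  by (simp add: idem_def lagrange_idem_def lagrange_def)

lemma theta_eq: "theta TYPE('n::finite) i = weight CARD('n) i"
  by (simp add: theta_def weight_def)

text \<open>Conjugation carries the whole resolution over. Hence only \<open>dual_adj_mat\<close>
  needs a direct check; \<open>eps_adj_mat\<close> and then \<open>adj_mat\<close> are reached
  through \<open>P_mat\<close>.\<close>

lemma weight_resolution_intertwine:
  fixes Y Y' P Q :: "'n::finite cmat"
  assumes PY: "\<And>x. P *v (Y *v x) = Y' *v (P *v x)" and PQ: "\<And>x. P *v (Q *v x) = x"
    and "weight_resolution CARD('n) Y (lagrange_idem Y)"
  shows "weight_resolution CARD('n) Y' (lagrange_idem Y')"
proof -
  interpret weight_resolution "CARD('n)" Y "lagrange_idem Y" by fact
  have *: "lagrange_idem Y' i *v x = P *v (lagrange_idem Y i *v (Q *v x))" for i x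
    using lagrange_intertwine[of P Y Y', OF PY] PQ unfolding lagrange_idem_def by metis
  have **: "Y' *v x = P *v (Y *v (Q *v x))" for x
    by (simp add: PY PQ)
  have QP: "Q *v (P *v x) = x" for x
  proof -
    have "P ** Q = mat 1" by (simp add: matrix_eq matrix_vector_mul_assoc[symmetric] PQ)
    then have "Q ** P = mat 1" by (simp add: matrix_left_right_inverse)
    then show ?thesis by (simp add: matrix_vector_mul_assoc)
  qed
  show ?thesis
  proof
    show "(\<Sum>i\<le>CARD('n). lagrange_idem Y' i *v x) = x" for x
      by (simp add: * vec.linear_sum[OF matrix_vector_mul_linear_gen, symmetric] F_sum PQ)
  qed (simp_all add: * ** QP F_big Y_F F_Y vector_scalar_commute)
qed

lemma bracket_intertwine:
  fixes X Y Z P :: "'n::finite cmat"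
  assumes "\<And>x. P *v (X *v x) = X' *v (P *v x)" "\<And>x. P *v (Y *v x) = Y' *v (P *v x)"
    "\<And>x. P *v (Z *v x) = Z' *v (P *v x)" and PQ: "\<And>x. P *v (Q *v x) = x"
    and "\<And>x. X *v (Y *v x) - Y *v (X *v x) = c *s (Z *v x)"
  shows "X' *v (Y' *v x) - Y' *v (X' *v x) = c *s (Z' *v x)"
proof -
  have "P *v (X *v (Y *v (Q *v x)) - Y *v (X *v (Q *v x))) = P *v (c *s (Z *v (Q *v x)))"
    by (simp only: assms(5))
  then show ?thesis
    by (simp only: assms(1-3) PQ vector_scalar_commute matrix_vector_mult_diff_distrib)
qed

section \<open>The hypercube\<close>

definition flip :: "'n \<Rightarrow> 'n::finite cube \<Rightarrow> 'n cube" where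
  "flip k y = (\<chi> l. if l = k then \<not> y $ l else y $ l)"

lemma flip_nth: "flip k y $ l = (if l = k then \<not> y $ l else y $ l)"
  by (simp add: flip_def)

lemma inj_flip: "inj (\<lambda>k. flip k y)"
proof (rule injI)
  fix k l assume "flip k y = flip l y"
  then have "flip k y $ k = flip l y $ k" by simp
  then show "k = l" by (simp add: flip_nth split: if_splits)
qed

lemma cube_adj_iff_flip: "cube_adj y z \<longleftrightarrow> z \<in> range (\<lambda>k. flip k y)"
proof
  assume "cube_adj y z"
  then obtain k where "{k. y $ k \<noteq> z $ k} = {k}"
    unfolding cube_adj_def by (auto simp: card_1_singleton_iff)
  then have "z = flip k y" by (auto simp: vec_eq_iff flip_nth set_eq_iff)
  then show "z \<in> range (\<lambda>k. flip k y)" by blast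
next
  assume "z \<in> range (\<lambda>k. flip k y)"
  then obtain k where z: "z = flip k y" by blast
  then have "{l. y $ l \<noteq> z $ l} = {k}" by (auto simp: flip_nth)
  then show "cube_adj y z" by (simp add: cube_adj_def)
qed

lemma cube_adj_sym: "cube_adj y z \<longleftrightarrow> cube_adj z y"
  by (simp add: cube_adj_def eq_commute)

lemma sum_adjacent:
  fixes g :: "'n::finite cube \<Rightarrow> 'a::comm_monoid_add"
  shows "(\<Sum>w\<in>UNIV. if cube_adj y w then g w else 0) = (\<Sum>k\<in>UNIV. g (flip k y))"
proof -
  have "(\<Sum>w\<in>UNIV. if cube_adj y w then g w else 0) = (\<Sum>w\<in>range (\<lambda>k. flip k y). g w)"
    by (intro sum.mono_neutral_cong_right) (auto simp: cube_adj_iff_flip)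
  also have "\<dots> = (\<Sum>k\<in>UNIV. g (flip k y))"
    by (simp add: sum.reindex[OF inj_flip])
  finally show ?thesis .
qed

text \<open>Each step changes one coordinate, and the Hamming distance satisfies the triangle
  inequality.\<close>

lemma walk_hamming: "(cube_adj ^^ n) y z \<Longrightarrow> card {k. y $ k \<noteq> z $ k} \<le> n"
proof (induction n arbitrary: z)
  case (Suc n)
  then obtain w where w: "(cube_adj ^^ n) y w" "cube_adj w z" by auto
  have "{k. y $ k \<noteq> z $ k} \<subseteq> {k. y $ k \<noteq> w $ k} \<union> {k. w $ k \<noteq> z $ k}" by auto
  then have "card {k. y $ k \<noteq> z $ k} \<le> card ({k. y $ k \<noteq> w $ k} \<union> {k. w $ k \<noteq> z $ k})"
    by (intro card_mono) auto
  also have "\<dots> \<le> card {k. y $ k \<noteq> w $ k} + card {k. w $ k \<noteq> z $ k}" by (rule card_Un_le)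
  also have "\<dots> \<le> Suc n" using Suc.IH[OF w(1)] w(2) by (simp add: cube_adj_def)
  finally show ?case .
qed simp

text \<open>Flipping a coordinate where \<open>z\<close> differs from \<open>y\<close> yields a
  neighbour of \<open>z\<close> one closer to \<open>y\<close>.\<close>

lemma hamming_walk: "(cube_adj ^^ card {k. y $ k \<noteq> z $ k}) y z"
proof (induction "card {k. y $ k \<noteq> z $ k}" arbitrary: z)
  case 0
  then show ?case by (simp add: vec_eq_iff)
next
  case (Suc n)
  then obtain k where k: "y $ k \<noteq> z $ k"
    by (metis (mono_tags, lifting) card.empty empty_Collect_eq nat.distinct(1))
  have "{l. y $ l \<noteq> flip k z $ l} = {l. y $ l \<noteq> z $ l} - {k}"
    using k by (auto simp: flip_nth)
  then have n: "card {l. y $ l \<noteq> flip k z $ l} = n"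
    using Suc(2) k by simp
  then have "(cube_adj ^^ n) y (flip k z)" using Suc(1)[of "flip k z"] by simp
  moreover have "cube_adj (flip k z) z" by (subst cube_adj_sym) (auto simp: cube_adj_iff_flip)
  ultimately have "(cube_adj ^^ Suc n) y z" by auto
  then show ?case by (simp only: Suc(2))
qed

lemma cube_dist_eq_hamming: "cube_dist y z = card {k. y $ k \<noteq> z $ k}"
  unfolding cube_dist_def by (intro Least_equality hamming_walk walk_hamming)

lemma cube_dist_base: "cube_dist base_vertex y = card {k. y $ k}"
  by (simp add: cube_dist_eq_hamming base_vertex_def)

section \<open>The diagonal matrix \<open>dual_adj_mat\<close> and its idempotents\<close>

abbreviation spin :: "bool \<Rightarrow> complex" where
  "spin b \<equiv> (if b then - 1 else 1)"

text \<open>The diagonal entry of \<open>dual_adj_mat\<close> as a sum of signs over the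
  coordinates, which suits the product form of \<open>P_mat\<close>.\<close>

definition dual_weight :: "'n::finite cube \<Rightarrow> complex" where
  "dual_weight y = (\<Sum>k\<in>UNIV. spin (y $ k))"

lemma dual_weight_eq: "dual_weight (y :: 'n::finite cube) = weight CARD('n) (cube_dist base_vertex y)"
proof -
  have "dual_weight y = (\<Sum>k\<in>UNIV. 1 - 2 * (if y $ k then 1 else 0))"
    unfolding dual_weight_def by (intro sum.cong) auto
  also have "\<dots> = of_nat CARD('n) - 2 * (\<Sum>k\<in>UNIV. if y $ k then 1 else 0)"
    by (simp add: sum_subtractf sum_distrib_left)
  also have "(\<Sum>k\<in>UNIV. if y $ k then 1 else 0) = (of_nat (card {k. y $ k}) :: complex)"
    by (simp add: sum.If_cases)
  finally show ?thesis by (simp add: weight_def cube_dist_base)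
qed

lemma cube_dist_base_le: "cube_dist base_vertex (y :: 'n::finite cube) \<le> CARD('n)"
  by (simp add: cube_dist_base card_mono)

lemma dual_weight_flip: "dual_weight (flip k y) = dual_weight y - 2 * spin (y $ k)"
proof -
  have "dual_weight (flip k y) - dual_weight y = (\<Sum>l\<in>UNIV. if l = k then - 2 * spin (y $ k) else 0)"
    unfolding dual_weight_def sum_subtractf[symmetric] by (intro sum.cong) (auto simp: flip_nth)
  then show ?thesis by (simp add: algebra_simps split: if_splits)
qed

lemma dual_adj_mat_nth: "dual_adj_mat $ y $ z = (if y = z then dual_weight y else 0)"
  by (simp add: dual_adj_mat_def dual_weight_eq weight_def)

lemma adj_mat_nth: "adj_mat $ y $ z = (if cube_adj y z then 1 else 0)"
  by (simp add: adj_mat_def)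

lemma eps_adj_mat_nth:
  "eps_adj_mat $ y $ z = (if cube_adj y z then - \<i> / 2 * (dual_weight z - dual_weight y) else 0)"
  by (simp add: eps_adj_mat_def mat_scale_def matrix_matrix_mult_def adj_mat_nth dual_adj_mat_nth
      if_distrib[of "\<lambda>x. _ * x"] if_distrib[of "\<lambda>x. x * _"] field_simps cong: if_cong)

lemma dual_adj_mult: "(dual_adj_mat *v x) $ y = dual_weight y * x $ y"
  by (simp add: matrix_vector_mult_def dual_adj_mat_nth if_distrib[of "\<lambda>x. x * _"] cong: if_cong)

lemma dual_idem_mult:
  "(dual_idem i *v x) $ y = (if cube_dist base_vertex y = i then x $ y else 0)"
proof -
  have "(dual_idem i *v x) $ y =
      (\<Sum>z\<in>UNIV. if y = z then (if cube_dist base_vertex y = i then x $ z else 0) else 0)"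
    unfolding matrix_vector_mult_def dual_idem_def vec_lambda_beta by (intro sum.cong) auto
  then show ?thesis by simp
qed

lemma lagrange_dual:
  "(lagrange (dual_adj_mat :: 'n::finite cmat) i js *v x) $ y =
     (\<Prod>j\<leftarrow>js. (dual_weight y - weight CARD('n) j) / (weight CARD('n) i - weight CARD('n) j)) * x $ y"
  by (induction js)
    (simp_all add: lagrange_Nil lagrange_Cons dual_adj_mult theta_eq algebra_simps diff_divide_distrib)

text \<open>A Lagrange polynomial is 1 at its own node and 0 at the others, and every diagonal entry
  is a node because distances are at most \<open>D\<close>. This brings \<open>dual_idem\<close>
  into the same form as the other two families.\<close>

lemma lagrange_idem_dual: "lagrange_idem dual_adj_mat i = (dual_idem i :: 'n::finite cmat)"
proof -
  let ?js = "filter (\<lambda>j. j \<noteq> i) [0..<Suc CARD('n)]"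
  have "(\<Prod>j\<leftarrow>?js. (dual_weight y - weight CARD('n) j) / (weight CARD('n) i - weight CARD('n) j))
      = (if cube_dist base_vertex y = i then 1 else 0)" for y :: "'n cube"
  proof (cases "cube_dist base_vertex y = i")
    case True
    then have "(\<Prod>j\<leftarrow>?js. (dual_weight y - weight CARD('n) j) / (weight CARD('n) i - weight CARD('n) j))
        = (\<Prod>j\<leftarrow>?js. 1)"
      by (intro arg_cong[of _ _ prod_list] map_cong)
        (auto simp: dual_weight_eq simp del: upt_Suc)
    moreover have "(\<Prod>j\<leftarrow>js. 1) = (1 :: complex)" for js :: "nat list"
      by (induction js) auto
    ultimately show ?thesis using True by simp
  next
    case False
    then have "cube_dist base_vertex y \<in> set ?js"
      using cube_dist_base_le[of y] by (simp add: less_Suc_eq_le del: upt_Suc)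
    moreover have "(dual_weight y - weight CARD('n) (cube_dist base_vertex y)) /
        (weight CARD('n) i - weight CARD('n) (cube_dist base_vertex y)) = 0"
      by (simp add: dual_weight_eq)
    ultimately have "(\<Prod>j\<leftarrow>?js. (dual_weight y - weight CARD('n) j) /
        (weight CARD('n) i - weight CARD('n) j)) = 0"
      unfolding prod_list_zero_iff set_map by (metis (no_types, lifting) image_eqI)
    then show ?thesis using False by simp
  qed
  then show ?thesis
    by (simp add: matrix_eq vec_eq_iff lagrange_idem_def lagrange_dual dual_idem_mult)
qed

lemma weight_resolution_dual:
  "weight_resolution CARD('n) (dual_adj_mat :: 'n::finite cmat) (lagrange_idem dual_adj_mat)"
proof
  show "(\<Sum>i\<le>CARD('n). lagrange_idem dual_adj_mat i *v x) = x" for x :: "'n cvec"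
    by (simp add: vec_eq_iff lagrange_idem_dual dual_idem_mult cube_dist_base_le)
next
  show "lagrange_idem dual_adj_mat i *v x = 0" if "i > CARD('n)" for i and x :: "'n cvec"
    using that by (auto simp: vec_eq_iff lagrange_idem_dual dual_idem_mult leD[OF cube_dist_base_le])
qed (auto simp: vec_eq_iff lagrange_idem_dual dual_idem_mult dual_adj_mult dual_weight_eq)

section \<open>The matrix \<open>P_mat\<close> and the cyclic intertwining\<close>

lemma P_mat_split:
  "P_mat $ y $ z = P1 (y $ k) (z $ k) * (\<Prod>l\<in>UNIV - {k}. P1 (y $ l) (z $ l))"
  by (simp add: P_mat_def prod.remove[of UNIV k])

text \<open>Only the factor of coordinate \<open>k\<close> changes, so this and the next rule reduce
  to the four entries of \<open>P1\<close>.\<close>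

lemma P_mat_flip_right: "P_mat $ y $ flip k z = spin (y $ k) * P_mat $ y $ z"
proof -
  have "(\<Prod>l\<in>UNIV - {k}. P1 (y $ l) (flip k z $ l)) = (\<Prod>l\<in>UNIV - {k}. P1 (y $ l) (z $ l))"
    by (intro prod.cong) (auto simp: flip_nth)
  then show ?thesis
    by (simp add: P_mat_split[of _ _ k] flip_nth P1_def)
qed

lemma P_mat_flip_left: "P_mat $ flip k y $ z = - \<i> * spin (y $ k) * spin (z $ k) * P_mat $ y $ z"
proof -
  have "(\<Prod>l\<in>UNIV - {k}. P1 (flip k y $ l) (z $ l)) = (\<Prod>l\<in>UNIV - {k}. P1 (y $ l) (z $ l))"
    by (intro prod.cong) (auto simp: flip_nth)
  then show ?thesis
    by (simp add: P_mat_split[of _ _ k] flip_nth P1_def mult.assoc[symmetric])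
qed

lemma dual_adj_matrix_mult: "(dual_adj_mat ** M) $ y $ z = dual_weight y * M $ y $ z"
  by (simp add: matrix_matrix_mult_def dual_adj_mat_nth if_distrib[of "\<lambda>x. x * _"] cong: if_cong)

lemma matrix_mult_dual_adj: "(M ** dual_adj_mat) $ y $ z = M $ y $ z * dual_weight z"
  by (simp add: matrix_matrix_mult_def dual_adj_mat_nth if_distrib[of "\<lambda>x. _ * x"] cong: if_cong)

lemma adj_matrix_mult: "(adj_mat ** M) $ y $ z = (\<Sum>k\<in>UNIV. M $ flip k y $ z)"
  using sum_adjacent[of y "\<lambda>w. M $ w $ z"]
  by (simp add: matrix_matrix_mult_def adj_mat_nth if_distrib[of "\<lambda>x. x * _"] cong: if_cong)

lemma matrix_mult_adj: "(M ** adj_mat) $ y $ z = (\<Sum>k\<in>UNIV. M $ y $ flip k z)"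
  using sum_adjacent[of z "\<lambda>w. M $ y $ w"]
  by (simp add: matrix_matrix_mult_def adj_mat_nth cube_adj_sym[of _ z]
      if_distrib[of "\<lambda>x. _ * x"] cong: if_cong)

lemma eps_adj_matrix_mult:
  "(eps_adj_mat ** M) $ y $ z = (\<Sum>k\<in>UNIV. \<i> * spin (y $ k) * M $ flip k y $ z)"
proof -
  have "(eps_adj_mat ** M) $ y $ z =
      (\<Sum>w\<in>UNIV. if cube_adj y w then - \<i> / 2 * (dual_weight w - dual_weight y) * M $ w $ z else 0)"
    unfolding matrix_matrix_mult_def by (auto simp: eps_adj_mat_nth intro!: sum.cong)
  also have "\<dots> = (\<Sum>k\<in>UNIV. \<i> * spin (y $ k) * M $ flip k y $ z)"
    unfolding sum_adjacent by (intro sum.cong) (auto simp: dual_weight_flip)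
  finally show ?thesis .
qed

lemma matrix_mult_eps_adj:
  "(M ** eps_adj_mat) $ y $ z = (\<Sum>k\<in>UNIV. M $ y $ flip k z * (- \<i> * spin (z $ k)))"
proof -
  have "(M ** eps_adj_mat) $ y $ z =
      (\<Sum>w\<in>UNIV. if cube_adj z w then M $ y $ w * (- \<i> / 2 * (dual_weight z - dual_weight w)) else 0)"
    unfolding matrix_matrix_mult_def
    by (auto simp: eps_adj_mat_nth cube_adj_sym[of _ z] intro!: sum.cong)
  also have "\<dots> = (\<Sum>k\<in>UNIV. M $ y $ flip k z * (- \<i> * spin (z $ k)))"
    unfolding sum_adjacent by (intro sum.cong) (auto simp: dual_weight_flip)
  finally show ?thesis .
qed

text \<open>In this and the next two identities the flip rules make both sides agree term by term in
  the sum over coordinates. Together they rotate \<open>adj_mat\<close>,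
  \<open>dual_adj_mat\<close>, \<open>eps_adj_mat\<close> cyclically.\<close>

lemma P_adj: "P_mat ** adj_mat = dual_adj_mat ** P_mat"
  by (simp add: vec_eq_iff matrix_mult_adj dual_adj_matrix_mult P_mat_flip_right
      sum_distrib_right dual_weight_def)

lemma P_dual_adj: "P_mat ** dual_adj_mat = eps_adj_mat ** P_mat"
  by (auto simp: vec_eq_iff matrix_mult_dual_adj eps_adj_matrix_mult P_mat_flip_left
      sum_distrib_left dual_weight_def intro!: sum.cong)

lemma P_eps_adj: "P_mat ** eps_adj_mat = adj_mat ** P_mat"
  by (auto simp: vec_eq_iff matrix_mult_eps_adj adj_matrix_mult P_mat_flip_left P_mat_flip_right
      intro!: sum.cong)

text \<open>Distributivity over the coordinates: products of Kronecker powers can be computed factor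
  by factor.\<close>

lemma sum_cube_prod:
  fixes g :: "'n::finite \<Rightarrow> bool \<Rightarrow> 'a::comm_semiring_1"
  shows "(\<Sum>w\<in>UNIV. \<Prod>k\<in>UNIV. g k (w $ k)) = (\<Prod>k\<in>UNIV. g k False + g k True)"
proof -
  have "(\<Prod>k\<in>UNIV. \<Sum>b\<in>UNIV. g k b) = (\<Sum>h\<in>UNIV. \<Prod>k\<in>UNIV. g k (h k))"
    using prod_sum_PiE[of UNIV "\<lambda>_. UNIV" g] by simp
  also have "\<dots> = (\<Sum>w\<in>UNIV. \<Prod>k\<in>UNIV. g k (w $ k))"
    by (rule sum.reindex_bij_witness[of _ vec_nth vec_lambda]) auto
  finally show ?thesis by (simp add: UNIV_bool add.commute)
qed

lemma P_mat_invertible: "invertible (P_mat :: 'n::finite cmat)"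
proof -
  \<comment> \<open>These are the entries of the inverse of the 2 by 2 matrix
    \<open>P1\<close>.\<close>
  define q where "q = (\<lambda>a b. (if \<not> b then 1 else if a then - \<i> else \<i>) / (2 :: complex))"
  define Q :: "'n cmat" where "Q = (\<chi> y z. \<Prod>k\<in>UNIV. q (y $ k) (z $ k))"
  have "(P_mat ** Q) $ y $ z = mat 1 $ y $ z" for y z :: "'n cube"
  proof -
    have "(P_mat ** Q) $ y $ z = (\<Sum>w\<in>UNIV. \<Prod>k\<in>UNIV. P1 (y $ k) (w $ k) * q (w $ k) (z $ k))"
      by (simp add: matrix_matrix_mult_def P_mat_def Q_def prod.distrib)
    also have "\<dots> = (\<Prod>k\<in>UNIV. if y $ k = z $ k then 1 else 0)"
      unfolding sum_cube_prod[of "\<lambda>k b. P1 (y $ k) b * q b (z $ k)"]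
      by (intro prod.cong) (auto simp: P1_def q_def)
    also have "\<dots> = (if y = z then 1 else 0)"
      by (auto simp: vec_eq_iff)
    finally show ?thesis by (simp add: mat_def)
  qed
  then have "P_mat ** Q = mat 1" by (simp add: vec_eq_iff)
  then show ?thesis unfolding invertible_def using matrix_left_right_inverse by blast
qed

lemma P_mat_inverse:
  fixes x :: "'n::finite cvec"
  shows "P_mat *v (matrix_inv P_mat *v x) = x" "matrix_inv P_mat *v (P_mat *v x) = x"
proof -
  have "P_mat ** matrix_inv P_mat = (mat 1 :: 'n cmat) \<and> matrix_inv P_mat ** P_mat = (mat 1 :: 'n cmat)"
    unfolding matrix_inv_def by (rule someI_ex[OF P_mat_invertible[unfolded invertible_def]])
  then show "P_mat *v (matrix_inv P_mat *v x) = x" "matrix_inv P_mat *v (P_mat *v x) = x"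
    by (simp_all add: matrix_vector_mul_assoc)
qed

lemma P_intertwine:
  "P_mat *v (adj_mat *v x) = dual_adj_mat *v (P_mat *v x)"
  "P_mat *v (dual_adj_mat *v x) = eps_adj_mat *v (P_mat *v x)"
  "P_mat *v (eps_adj_mat *v x) = adj_mat *v (P_mat *v x)"
  by (simp_all add: matrix_vector_mul_assoc P_adj P_dual_adj P_eps_adj)

text \<open>Conjugating a polynomial in \<open>adj_mat\<close> by \<open>P_mat\<close> gives the
  same polynomial in \<open>eps_adj_mat\<close>.\<close>

lemma eps_idem_eq: "eps_idem i = lagrange_idem eps_adj_mat i"
proof -
  have "eps_idem i *v x = lagrange_idem eps_adj_mat i *v x" for x :: "'a cvec"
    unfolding eps_idem_def idem_eq lagrange_idem_def matrix_vector_mul_assoc[symmetric]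
    by (simp add: lagrange_intertwine[OF P_intertwine(3), symmetric] P_mat_inverse)
  then show ?thesis by (simp add: matrix_eq)
qed

lemma weight_resolution_eps:
  "weight_resolution CARD('n) (eps_adj_mat :: 'n::finite cmat) (lagrange_idem eps_adj_mat)"
  by (rule weight_resolution_intertwine[OF P_intertwine(2) P_mat_inverse(1) weight_resolution_dual])

lemma weight_resolution_adj:
  "weight_resolution CARD('n) (adj_mat :: 'n::finite cmat) (lagrange_idem adj_mat)"
  by (rule weight_resolution_intertwine[OF P_intertwine(3) P_mat_inverse(1) weight_resolution_eps])

section \<open>Commutation relations and submodules\<close>

lemma bracket_adj_dual:
  "adj_mat *v (dual_adj_mat *v x) - dual_adj_mat *v (adj_mat *v x) = (2 * \<i>) *s (eps_adj_mat *v x)"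
  by (simp add: eps_adj_mat_def matrix_vector_mult_diff_rdistrib matrix_vector_mul_assoc)

text \<open>Conjugation by \<open>P_mat\<close> rotates the relation that defines
  \<open>eps_adj_mat\<close>.\<close>

lemma bracket_dual_eps:
  "dual_adj_mat *v (eps_adj_mat *v x) - eps_adj_mat *v (dual_adj_mat *v x) = (2 * \<i>) *s (adj_mat *v x)"
  by (rule bracket_intertwine[OF P_intertwine P_mat_inverse(1) bracket_adj_dual])

lemma bracket_eps_adj:
  "eps_adj_mat *v (adj_mat *v x) - adj_mat *v (eps_adj_mat *v x) = (2 * \<i>) *s (dual_adj_mat *v x)"
  by (rule bracket_intertwine[OF P_intertwine(2,3,1) P_mat_inverse(1) bracket_dual_eps])

text \<open>The matrices that preserve a subspace form a subalgebra, so the two generators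
  suffice.\<close>

lemma T_module_iff:
  "T_module W \<longleftrightarrow> vec.subspace W \<and> (\<forall>w\<in>W. adj_mat *v w \<in> W \<and> dual_adj_mat *v w \<in> W)"
proof
  assume "T_module W"
  moreover have "adj_mat \<in> terwilliger_algebra" "dual_adj_mat \<in> terwilliger_algebra"
    unfolding terwilliger_algebra_def by (simp_all add: hull_inc)
  ultimately show "vec.subspace W \<and> (\<forall>w\<in>W. adj_mat *v w \<in> W \<and> dual_adj_mat *v w \<in> W)"
    unfolding T_module_def by blast
next
  assume *: "vec.subspace W \<and> (\<forall>w\<in>W. adj_mat *v w \<in> W \<and> dual_adj_mat *v w \<in> W)"
  have "complex_subalgebra {M. \<forall>w\<in>W. M *v w \<in> W}"
    unfolding complex_subalgebra_def
    using * by (auto simp: matrix_vector_mult_add_rdistrib matrix_vector_mul_assoc[symmetric]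
        intro: vec.subspace_add vec.subspace_scale)
  then have "terwilliger_algebra \<subseteq> {M. \<forall>w\<in>W. M *v w \<in> W}"
    unfolding terwilliger_algebra_def using * by (intro hull_minimal) auto
  with * show "T_module W" unfolding T_module_def by blast
qed

lemma bracket_mem:
  assumes "X *v (Y *v w) - Y *v (X *v w) = (2 * \<i>) *s (Z *v w)" "vec.subspace W"
    "\<And>w. w \<in> W \<Longrightarrow> X *v w \<in> W" "\<And>w. w \<in> W \<Longrightarrow> Y *v w \<in> W" "w \<in> W"
  shows "Z *v w \<in> W"
proof -
  have "Z *v w = (1 / (2 * \<i>)) *s (X *v (Y *v w) - Y *v (X *v w))"
    by (simp add: assms(1))
  then show ?thesis
    using assms(2-) by (simp only:) (intro vec.subspace_scale vec.subspace_diff; blast)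
qed

lemma Min_atLeastAtMost: "a \<le> b \<Longrightarrow> Min {a..b} = a" for a b :: nat
  by (rule Min_eqI) auto

theorem theorem10p4:
  fixes W :: "'n::finite cvec set"
    and r d :: nat
    and u ustar ueps :: "'n cvec"
  assumes "irreducible_T_module W"
    and "r = endpoint W"
    and "d = diameter_of W"
    and "u \<in> (*v) (idem r) ` W" and "u \<noteq> 0"
    and "ustar \<in> (*v) (dual_idem r) ` W" and "ustar \<noteq> 0"
    and "ueps \<in> (*v) (eps_idem r) ` W" and "ueps \<noteq> 0"
  shows "represents d (tridiag d) adj_mat (\<lambda>i. dual_idem (r + i) *v ueps) W
       \<and> represents d (tridiag d) dual_adj_mat (\<lambda>i. eps_idem (r + i) *v u) W
       \<and> represents d (tridiag d) eps_adj_mat (\<lambda>i. idem (r + i) *v ustar) W"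
proof -
  let ?A = "adj_mat :: 'n cmat" and ?B = "dual_adj_mat :: 'n cmat" and ?C = "eps_adj_mat :: 'n cmat"
  have W: "vec.subspace W" "W \<noteq> {0}"
    and WA: "\<And>w. w \<in> W \<Longrightarrow> ?A *v w \<in> W" and WB: "\<And>w. w \<in> W \<Longrightarrow> ?B *v w \<in> W"
    using assms(1) unfolding irreducible_T_module_def T_module_iff by auto
  have WC: "?C *v w \<in> W" if "w \<in> W" for w
    by (rule bracket_mem[OF bracket_adj_dual W(1) WA WB that])
  have irr: "U = {0} \<or> U = W" if "vec.subspace U" "U \<subseteq> W" "\<And>w. w \<in> U \<Longrightarrow> ?A *v w \<in> U"
    "\<And>w. w \<in> U \<Longrightarrow> ?B *v w \<in> U" for U
    using assms(1) that unfolding irreducible_T_module_def T_module_iff by blast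
  note WF = lagrange_invariant[OF W(1) WA, folded lagrange_idem_def]
    lagrange_invariant[OF W(1) WB, folded lagrange_idem_def]
    lagrange_invariant[OF W(1) WC, folded lagrange_idem_def]
  interpret A: weight_resolution "CARD('n)" ?A "lagrange_idem ?A" by (rule weight_resolution_adj)
  interpret B: weight_resolution "CARD('n)" ?B "lagrange_idem ?B" by (rule weight_resolution_dual)
  interpret C: weight_resolution "CARD('n)" ?C "lagrange_idem ?C" by (rule weight_resolution_eps)
  \<comment> \<open>The three rotations correspond to claims (i), (ii) and (iii), in this
    order.\<close>
  interpret I1: irreducible_triple "CARD('n)" ?A ?B ?C "lagrange_idem ?B" "lagrange_idem ?C" W
    by unfold_locales
      (use W WA WB WF irr in \<open>auto simp: bracket_adj_dual bracket_dual_eps bracket_eps_adj lagrange_idem_def\<close>)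
  interpret I2: irreducible_triple "CARD('n)" ?B ?C ?A "lagrange_idem ?C" "lagrange_idem ?A" W
    by unfold_locales
      (use W WA WB WC WF irr in \<open>auto simp: bracket_adj_dual bracket_dual_eps bracket_eps_adj lagrange_idem_def\<close>)
  interpret I3: irreducible_triple "CARD('n)" ?C ?A ?B "lagrange_idem ?A" "lagrange_idem ?B" W
    by unfold_locales
      (use W WA WB WC WF irr in \<open>auto simp: bracket_adj_dual bracket_dual_eps bracket_eps_adj lagrange_idem_def\<close>)
  have Min_support: "\<exists>w. w \<in> (*v) (F (Min (support CARD('n) F W))) ` W \<and> w \<noteq> 0"
    if "support CARD('n) F W \<noteq> {}" for F
  proof -
    have "Min (support CARD('n) F W) \<in> support CARD('n) F W"
      using that by (intro Min_in finite_support)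
    then show ?thesis using vec.subspace_0[OF W(1)] unfolding support_def by force
  qed
  \<comment> \<open>Each support is computed in the rotation where its matrix plays the role of
    \<open>Y\<close>.\<close>
  have sB: "support CARD('n) (lagrange_idem ?B) W = {I1.r..CARD('n) - I1.r}" "2 * I1.r \<le> CARD('n)"
    using Min_support[OF C.support_nonempty[OF W]] I1.represents_tridiag(2,3) by blast+
  have sC: "support CARD('n) (lagrange_idem ?C) W = {I2.r..CARD('n) - I2.r}" "2 * I2.r \<le> CARD('n)"
    using Min_support[OF A.support_nonempty[OF W]] I2.represents_tridiag(2,3) by blast+
  have dual: "dual_support W = support CARD('n) (lagrange_idem ?B) W"
    by (simp add: dual_support_def support_def lagrange_idem_dual)
  \<comment> \<open>In \<open>I3\<close> the role of \<open>Z\<close> falls to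
    \<open>dual_adj_mat\<close>, whose support defines the endpoint.\<close>
  have r3: "I3.r = r"
    by (simp add: assms(2) endpoint_def dual)
  \<comment> \<open>The support of \<open>dual_adj_mat\<close> starts at \<open>I1.r\<close> by
    \<open>sB\<close>, while its minimum is \<open>I3.r\<close>; one more turn of the cycle gives
    \<open>r2\<close>.\<close>
  have r1: "I1.r = r"
    using sB r3 by (simp add: Min_atLeastAtMost)
  have r2: "I2.r = r"
    using sC r1 by (simp add: Min_atLeastAtMost)
  have d: "d = CARD('n) - 2 * r"
    using sB by (simp add: assms(3) diameter_of_def dual r1)
  show ?thesis
    using I1.represents_tridiag(1)[of ueps] I2.represents_tridiag(1)[of u]
      I3.represents_tridiag(1)[of ustar] assms(4-)
    unfolding r1 r2 r3 d idem_eq eps_idem_eq lagrange_idem_dual by blast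
qed

end
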